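(* Let $T$ be the map that sends each word $w$ of the permuted Farey-Christoffel tree $\hat{\mathcal F}$ to the next one, reading $\hat{\mathcal F}$ row by row, from left to right, starting from the root (the last word of a row being sent to the first word of the following row). Then $T=T_0\cup T_1$, where $T_0:\mathcal F_{<1}\to\mathcal F_{\ge1}$ and $T_1:\mathcal F_{\ge1}\to\mathcal F_{<1}$ act blockwise by $$T_0:\ (0^{k+1}1,\ 0^k1)\to\big((01)^k1,\ (01)^{k-1}1\big),$$ $$T_1:\ (01^{k+1},\ 01^k)\to(0^k1,\ 0^{k+1}1),$$ where $k$ is the value of $w$. That is, $T(w)$ is obtained from $w\in\mathcal F_{<1}$ by replacing each block $0^{k+1}1$ by $(01)^k1$ and each block $0^k1$ by $(01)^{k-1}1$, and from $w\in\mathcal F_{\ge1}$ by replacing each block $01^{k+1}$ by $0^k1$ and each block $01^k$ by $0^{k+1}1$.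
   Context: All fractions are in lowest terms; $\frac01$ and $\frac10$ are allowed as formal fractions. A pair of nonnegative fractions $\frac ab<\frac cd$ is a Farey pair if $bc-ad=1$; its mediant is $\frac{a+c}{b+d}$. Every positive rational is the mediant of exactly one Farey pair. Farey-Christoffel (FC) words: $w_{0/1}=0$, $w_{1/0}=1$, and $w_{p/q}=w_{p'/q'}\,w_{p''/q''}$ (concatenation) whenever $\frac{p'}{q'}<\frac{p''}{q''}$ is a Farey pair with mediant $\frac pq$. $\mathcal F=\{w_x:x\in\mathbb Q,\ x>0\}$. The slope of $w\in\mathcal F$ is $|w|_1/|w|_0$ (where $|w|_s$ counts occurrences of $s$), and $w_{p/q}$ has slope $p/q$. $\mathcal F_{<1}$ and $\mathcal F_{\ge1}$ are the sets of FC words of slope $<1$ and $\ge1$ respectively. The permuted tree $\hat{\mathcal T}$ is the binary tree with root $\frac11$ in which each vertex $\frac pq$ has left descendant $\frac p{p+q}$ and right descendant $\frac{p+q}q$; it contains every positive rational exactly once. $\hat{\mathcal F}$ is the tree obtained from it by replacing each $x$ by $w_x$. An FC word of slope $p/q<1$ can be written $0^{n_1}1\,0^{n_2}1\cdots0^{n_p}1$ with each $n_i\in\{k,k+1\}$, where $k=\lfloor q/p\rfloor$; an FC word of slope $p/q\ge1$ can be written $0\,1^{n_1}0\,1^{n_2}\cdots0\,1^{n_q}$ with each $n_i\in\{k,k+1\}$, where $k=\lfloor p/q\rfloor$. The integer $k\ge1$ is called the value of $w$. For a word $a$, $a^0$ is the empty word. *)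

theory Defs
  imports Complex_Main
begin

section \<open>Formal fractions and Farey pairs\<close>

text \<open>
  A (formal) fraction \<open>p/q\<close> in lowest terms is the pair \<open>(p, q)\<close> of coprime natural numbers;
  \<open>0/1\<close> and \<open>1/0\<close> are the pairs \<open>(0, 1)\<close> and \<open>(1, 0)\<close>.
\<close>

type_synonym fraction = "nat \<times> nat"

definition pos_fraction :: "fraction \<Rightarrow> bool" where
  "pos_fraction = (\<lambda>(p, q). 0 < p \<and> 0 < q \<and> coprime p q)"

text \<open>
  The equation \<open>b c - a d = 1\<close>, stated over the naturals. It implies both \<open>a/b < c/d\<close>
  (that is \<open>a d < b c\<close>, also for the formal fractions) and that the two fractions are in
  lowest terms.
\<close>

definition farey_pair :: "fraction \<Rightarrow> fraction \<Rightarrow> bool" where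
  "farey_pair = (\<lambda>(a, b) (c, d). b * c = a * d + 1)"

definition mediant :: "fraction \<Rightarrow> fraction \<Rightarrow> fraction" where
  "mediant = (\<lambda>(a, b) (c, d). (a + c, b + d))"


section \<open>Farey-Christoffel words\<close>

type_synonym word = "nat list"

inductive is_fc_word :: "fraction \<Rightarrow> word \<Rightarrow> bool" where
  zero: "is_fc_word (0, 1) [0]"
| infinity: "is_fc_word (1, 0) [1]"
| mediant: "farey_pair x y \<Longrightarrow> is_fc_word x u \<Longrightarrow> is_fc_word y v \<Longrightarrow>
    is_fc_word (mediant x y) (u @ v)"

text \<open>The definite description is justified by \<open>is_fc_word_ex1\<close> below.\<close>

definition fc_word :: "fraction \<Rightarrow> word" where
  "fc_word x = (THE w. is_fc_word x w)"

lemma farey_parents_exist: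
  assumes "0 < p" "0 < q" "coprime p q"
  shows "\<exists>x y. farey_pair x y \<and> mediant x y = (p, q)"
  using assms
proof (induction "p + q" arbitrary: p q rule: less_induct)
  case less
  consider "p < q" | "q < p" | "p = q" by linarith
  then show ?case
  proof cases
    case 1
    have "coprime p (q - p)"
      using less.prems(3) 1 by (metis coprime_iff_gcd_eq_1 gcd.commute gcd_diff1_nat less_imp_le)
    with less.hyps[of p "q - p"] less.prems 1
    obtain a b c d where "b * c = a * d + 1" "a + c = p" "b + d = q - p"
      by (auto simp: farey_pair_def mediant_def)
    then show ?thesis using 1
      by (intro exI[of _ "(a, b + a)"] exI[of _ "(c, d + c)"])
        (simp add: farey_pair_def mediant_def algebra_simps)
  next
    case 2
    have "coprime (p - q) q"
      using less.prems(3) 2 by (metis coprime_iff_gcd_eq_1 gcd_diff1_nat less_imp_le)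
    with less.hyps[of "p - q" q] less.prems 2
    obtain a b c d where "b * c = a * d + 1" "a + c = p - q" "b + d = q"
      by (auto simp: farey_pair_def mediant_def)
    then show ?thesis using 2
      by (intro exI[of _ "(a + b, b)"] exI[of _ "(c + d, d)"])
        (simp add: farey_pair_def mediant_def algebra_simps)
  next
    case 3
    then have "p = 1" "q = 1" using less.prems by auto
    then show ?thesis
      by (intro exI[of _ "(0, 1)"] exI[of _ "(1, 0)"]) (simp add: farey_pair_def mediant_def)
  qed
qed

lemma farey_parents_unique:
  assumes xy: "farey_pair x y" and xy': "farey_pair x' y'" and m: "mediant x y = mediant x' y'"
  shows "x = x' \<and> y = y'"
proof -
  obtain a b c d a' b' c' d' where v: "x = (a, b)" "y = (c, d)" "x' = (a', b')" "y' = (c', d')"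
    by (metis surj_pair)
  have e: "int b * int c = int a * int d + 1" "int b' * int c' = int a' * int d' + 1"
    using xy xy' unfolding v farey_pair_def
    by (simp_all flip: of_nat_mult of_nat_Suc)
  have s: "a + c = a' + c'" "b + d = b' + d'"
    using m by (simp_all add: v mediant_def)
  then have s': "int a + int c = int a' + int c'" "int b + int d = int b' + int d'"
    by linarith+
  \<comment> \<open>the difference of the two left parents is \<open>(t p, t q)\<close>, where \<open>p/q\<close> is the mediant\<close>
  define t where "t = int a * int b' - int b * int a'"
  have c': "int c' = int a + int c - int a'" and d': "int d' = int b + int d - int b'"
    using s' by linarith+
  have e2: "int b' * (int a + int c) - int a' * (int b + int d) = 1"
    using e(2) unfolding c' d' by (simp add: algebra_simps)
  have "int a' - int a = - t * (int a + int c)" "int b' - int b = - t * (int b + int d)"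
    using e(1) e2 unfolding t_def by algebra+
  moreover have "1 \<le> b" "1 \<le> c" "1 \<le> b'" "1 \<le> c'"
    using xy xy' by (auto simp: v farey_pair_def Suc_le_eq intro!: Nat.gr0I)
  ultimately have dt: "int a' - int a = - t * (int a + int c)"
      "int b' - int b = - t * (int b + int d)" and pos: "1 \<le> b" "1 \<le> c" "1 \<le> b'" "1 \<le> c'"
    by auto
  have "\<bar>int a' - int a\<bar> < int a + int c"
    using s(1) pos by linarith
  then have "\<bar>t\<bar> * (int a + int c) < 1 * (int a + int c)"
    unfolding dt(1) abs_mult abs_minus_cancel by simp
  then have "\<bar>t\<bar> < 1"
    by (rule mult_right_less_imp_less) simp
  then have "t = 0" by simp
  then show ?thesis using dt s by (simp add: v)
qed

lemma farey_pair_lowest_terms: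
  assumes "farey_pair x y"
  shows "coprime (fst x) (snd x)" "coprime (fst y) (snd y)"
    "coprime (fst (mediant x y)) (snd (mediant x y))"
proof -
  obtain a b c d where v: "x = (a, b)" "y = (c, d)" by (metis surj_pair)
  have e: "b * c = a * d + 1" using assms by (simp add: v farey_pair_def)
  have "is_unit k" if "k dvd a" "k dvd b" for k
  proof -
    have "k dvd a * d" "k dvd a * d + 1" using that unfolding e[symmetric] by auto
    then show ?thesis using dvd_add_right_iff by blast
  qed
  then show "coprime (fst x) (snd x)" by (auto simp: v intro: coprimeI)
  have "is_unit k" if "k dvd c" "k dvd d" for k
  proof -
    have "k dvd a * d" "k dvd a * d + 1" using that unfolding e[symmetric] by auto
    then show ?thesis using dvd_add_right_iff by blast
  qed
  then show "coprime (fst y) (snd y)" by (auto simp: v intro: coprimeI)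
  have "is_unit k" if "k dvd a + c" "k dvd b + d" for k
  proof -
    have "k dvd a * (b + d)" "k dvd b * (a + c)" using that by auto
    moreover have "b * (a + c) = a * (b + d) + 1" using e by (simp add: algebra_simps)
    ultimately show ?thesis using dvd_add_right_iff by metis
  qed
  then show "coprime (fst (mediant x y)) (snd (mediant x y))"
    by (auto simp: v mediant_def intro: coprimeI)
qed

lemma farey_pair_pos:
  assumes "farey_pair x y"
  shows "0 < snd x" "0 < fst y"
  using assms by (cases x; cases y; auto simp: farey_pair_def intro!: Nat.gr0I)+

lemma is_fc_word_exists:
  assumes "coprime (fst x) (snd x)"
  shows "\<exists>w. is_fc_word x w"
  using assms
proof (induction "fst x + snd x" arbitrary: x rule: less_induct)
  case less
  obtain p q where x: "x = (p, q)" by fastforce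
  consider "p = 0" | "q = 0" | "0 < p" "0 < q" by auto
  then show ?case
  proof cases
    case 1
    then have "x = (0, 1)" using less.prems by (simp add: x)
    then show ?thesis using is_fc_word.zero by auto
  next
    case 2
    then have "x = (1, 0)" using less.prems by (simp add: x)
    then show ?thesis using is_fc_word.infinity by auto
  next
    case 3
    obtain y z where yz: "farey_pair y z" "mediant y z = (p, q)"
      using farey_parents_exist[OF 3] less.prems by (auto simp: x)
    have "fst y + snd y < fst x + snd x" "fst z + snd z < fst x + snd x"
      using yz(2) farey_pair_pos[OF yz(1)]
      by (cases y; cases z; simp add: x mediant_def; linarith)+
    then obtain u v where "is_fc_word y u" "is_fc_word z v"
      using less.hyps farey_pair_lowest_terms[OF yz(1)] by metis
    then show ?thesis using is_fc_word.mediant[OF yz(1)] by (auto simp: x yz(2))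
  qed
qed

lemma is_fc_word_unique:
  "is_fc_word x w \<Longrightarrow> is_fc_word x w' \<Longrightarrow> w' = w"
proof (induction arbitrary: w' rule: is_fc_word.induct)
  case zero
  then show ?case
    by (cases rule: is_fc_word.cases)
      (use farey_pair_pos in \<open>fastforce simp: mediant_def split: prod.splits\<close>)+
next
  case infinity
  then show ?case
    by (cases rule: is_fc_word.cases)
      (use farey_pair_pos in \<open>fastforce simp: mediant_def split: prod.splits\<close>)+
next
  case (mediant x y u v)
  have pos: "0 < fst (mediant x y)" "0 < snd (mediant x y)"
    using farey_pair_pos[OF mediant.hyps(1)] by (cases x; cases y; simp add: mediant_def)+
  from mediant.prems show ?case
  proof (cases rule: is_fc_word.cases)
    case zero
    then show ?thesis using pos by simp
  next
    case infinity
    then show ?thesis using pos by simp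
  next
    case (mediant x' y' u' v')
    then have "x = x' \<and> y = y'"
      using farey_parents_unique[OF mediant.hyps(1)] by metis
    then show ?thesis using mediant mediant.IH by auto
  qed
qed

lemma is_fc_word_ex1: "coprime p q \<Longrightarrow> \<exists>!w. is_fc_word (p, q) w"
  using is_fc_word_exists[of "(p, q)"] is_fc_word_unique by auto

lemma is_fc_word_fc_word: "coprime p q \<Longrightarrow> is_fc_word (p, q) (fc_word (p, q))"
  unfolding fc_word_def by (rule theI'[OF is_fc_word_ex1])

definition FC :: "word set" where
  "FC = {fc_word x | x. pos_fraction x}"

definition slope :: "word \<Rightarrow> rat" where
  "slope w = of_nat (count_list w 1) / of_nat (count_list w 0)"

definition FC_lt1 :: "word set" where
  "FC_lt1 = {w \<in> FC. slope w < 1}"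

definition FC_ge1 :: "word set" where
  "FC_ge1 = {w \<in> FC. slope w \<ge> 1}"

text \<open>For a word of slope \<open>p/q\<close>, this is \<open>\<lfloor>q/p\<rfloor>\<close> if \<open>p/q < 1\<close> and \<open>\<lfloor>p/q\<rfloor>\<close> otherwise.\<close>

definition fc_value :: "word \<Rightarrow> nat" where
  "fc_value w = (if slope w < 1 then nat \<lfloor>1 / slope w\<rfloor> else nat \<lfloor>slope w\<rfloor>)"


section \<open>The permuted tree\<close>

text \<open>
  \<open>that_row n\<close> is the \<open>n\<close>-th row of the tree, read from left to right: the descendants of the
  vertices of a row, in order, make up the following row.
\<close>

fun that_row :: "nat \<Rightarrow> fraction list" where
  "that_row 0 = [(1, 1)]"
| "that_row (Suc n) = concat (map (\<lambda>(p, q). [(p, p + q), (p + q, q)]) (that_row n))"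

definition fhat_row :: "nat \<Rightarrow> word list" where
  "fhat_row n = map fc_word (that_row n)"

text \<open>The graph of the map \<open>T\<close>: pairs of consecutive words in the row-by-row reading.\<close>

definition T_map :: "(word \<times> word) set" where
  "T_map = {(fhat_row n ! i, fhat_row n ! Suc i) | n i. Suc i < length (fhat_row n)}
         \<union> {(last (fhat_row n), hd (fhat_row (Suc n))) | n. True}"


section \<open>The blockwise maps\<close>

definition word_power :: "word \<Rightarrow> nat \<Rightarrow> word" where
  "word_power a n = concat (replicate n a)"

text \<open>
  The graphs of the two maps. The list \<open>ns\<close> is the sequence of exponents of the block
  decomposition of \<open>w\<close>.
\<close>

definition T0_map :: "(word \<times> word) set" where
  "T0_map = {(w, w'). w \<in> FC_lt1 \<and> (\<exists>ns k. k = fc_value w \<and> set ns \<subseteq> {k, k + 1} \<and>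
     w = concat (map (\<lambda>n. word_power [0] n @ [1]) ns) \<and>
     w' = concat (map (\<lambda>n. if n = k + 1 then word_power [0, 1] k @ [1]
                            else word_power [0, 1] (k - 1) @ [1]) ns))}"

definition T1_map :: "(word \<times> word) set" where
  "T1_map = {(w, w'). w \<in> FC_ge1 \<and> (\<exists>ns k. k = fc_value w \<and> set ns \<subseteq> {k, k + 1} \<and>
     w = concat (map (\<lambda>n. [0] @ word_power [1] n) ns) \<and>
     w' = concat (map (\<lambda>n. if n = k + 1 then word_power [0] k @ [1]
                            else word_power [0] (k + 1) @ [1]) ns))}"

text \<open>\<open>R\<close> is the graph of a function from \<open>A\<close> to \<open>B\<close>.\<close>

definition function_graph :: "'a set \<Rightarrow> 'b set \<Rightarrow> ('a \<times> 'b) set \<Rightarrow> bool" where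
  "function_graph A B R \<longleftrightarrow> single_valued R \<and> Domain R = A \<and> Range R \<subseteq> B"

end

(* With L and R the two descendants in the tree, two neighbours in a row are reached from a
   common ancestor (a, b) by the paths L R^j and R L^j; the step from the end of a row to the
   next row has the same form with (a, b) = (0, 1). Every such path is a unimodular change of
   basis, under which the FC word transforms by a substitution of FC words for the two
   letters. Comparing the substitutions of the two paths gives the blockwise maps: T0 for
   j = 0, and T1 with value k = j otherwise. *)
theory Submission
  imports Defs
begin

section \<open>FC words under substitution of letters\<close>

definition subst :: "word \<Rightarrow> word \<Rightarrow> word \<Rightarrow> word" where
  "subst A B w = concat (map (\<lambda>s. if s = 0 then A else B) w)"

text \<open>Exponent lists will be relabellings of a shorter FC word; this turns a blockwise
  description over such a list into a substitution of two blocks for the two letters.\<close>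

lemma concat_blocks_eq_subst:
  "concat (map f (map (\<lambda>s. if s = 0 then m else n) w)) = subst (f m) (f n) w"
  by (induction w) (simp_all add: subst_def)

text \<open>The two fractions are the columns of a unimodular matrix, which preserves Farey pairs
  and mediants, so substitution commutes with the recursive construction of FC words. Each of the
  \<open>snd x\<close> zeros contributes \<open>(a, b)\<close>, each of the \<open>fst x\<close>
  ones \<open>(c, d)\<close>.\<close>

lemma is_fc_word_subst:
  assumes ab: "farey_pair (a, b) (c, d)" and A: "is_fc_word (a, b) A" and B: "is_fc_word (c, d) B"
    and w: "is_fc_word x w"
  shows "is_fc_word (snd x * a + fst x * c, snd x * b + fst x * d) (subst A B w)"
  using w
proof (induction rule: is_fc_word.induct)
  case zero
  then show ?case using A by (simp add: subst_def)
next
  case infinity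
  then show ?case using B by (simp add: subst_def)
next
  case (mediant x y u v)
  obtain p q r s where xy: "x = (p, q)" "y = (r, s)" by (metis surj_pair)
  have 1: "q * r = p * s + 1" and 2: "b * c = a * d + 1"
    using mediant.hyps(1) ab by (simp_all add: xy farey_pair_def)
  \<comment> \<open>Over the integers, the determinant of the image pair is the product of the
    determinants of the two given pairs.\<close>
  have "int q * int r = int p * int s + 1" "int b * int c = int a * int d + 1"
    using 1 2 by (simp_all flip: of_nat_mult of_nat_Suc)
  then have "int ((q * b + p * d) * (s * a + r * c)) = int ((q * a + p * c) * (s * b + r * d) + 1)"
    unfolding of_nat_mult of_nat_add of_nat_1 by algebra
  then have "(q * b + p * d) * (s * a + r * c) = (q * a + p * c) * (s * b + r * d) + 1"
    by (simp only: of_nat_eq_iff)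
  then have "farey_pair (q * a + p * c, q * b + p * d) (s * a + r * c, s * b + r * d)"
    by (simp add: farey_pair_def)
  from is_fc_word.mediant[OF this] mediant.IH
  show ?case by (simp add: xy mediant_def subst_def algebra_simps)
qed

lemma is_fc_word_count:
  "is_fc_word x w \<Longrightarrow> count_list w 1 = fst x \<and> count_list w 0 = snd x"
  by (induction rule: is_fc_word.induct) (auto simp: mediant_def split: prod.splits)

lemma fc_word_eq: "is_fc_word (p, q) w \<Longrightarrow> fc_word (p, q) = w"
  unfolding fc_word_def using is_fc_word_unique by blast

lemma slope_fc_word: "coprime p q \<Longrightarrow> slope (fc_word (p, q)) = of_nat p / of_nat q"
  using is_fc_word_count[OF is_fc_word_fc_word] by (simp add: slope_def)

lemma fc_word_subst:
  assumes "farey_pair (a, b) (c, d)" "is_fc_word (a, b) A" "is_fc_word (c, d) B" "coprime p q"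
  shows "fc_word (q * a + p * c, q * b + p * d) = subst A B (fc_word (p, q))"
  using fc_word_eq[OF is_fc_word_subst[OF assms(1-3) is_fc_word_fc_word[OF assms(4)], simplified]] .

section \<open>The blocks of the two maps as FC words\<close>

lemma word_power_Suc: "word_power a (Suc n) = a @ word_power a n"
  by (simp add: word_power_def)

lemma word_power_single: "word_power [s] n = replicate n s"
  by (induction n) (simp_all add: word_power_def)

lemma is_fc_word_zeros_one: "is_fc_word (1, j) (word_power [0] j @ [1])"
proof (induction j)
  case 0
  then show ?case using is_fc_word.infinity by (simp add: word_power_def)
next
  case (Suc j)
  from is_fc_word.mediant[OF _ is_fc_word.zero this] show ?case
    by (simp add: farey_pair_def mediant_def word_power_Suc)
qed

lemma is_fc_word_zero_ones: "is_fc_word (j, 1) ([0] @ word_power [1] j)"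
proof (induction j)
  case 0
  then show ?case using is_fc_word.zero by (simp add: word_power_def)
next
  case (Suc j)
  from is_fc_word.mediant[OF _ this is_fc_word.infinity] show ?case
    by (simp add: farey_pair_def mediant_def word_power_single replicate_append_same)
qed

text \<open>Each step is a mediant with left parent 1/1, whose word \<open>[0, 1]\<close> is
  prepended.\<close>

lemma is_fc_word_alternating: "is_fc_word (Suc j, j) (word_power [0, 1] j @ [1])"
proof (induction j)
  case 0
  then show ?case using is_fc_word.infinity by (simp add: word_power_def)
next
  case (Suc j)
  have "is_fc_word (1, 1) [0, 1]"
    using is_fc_word_zero_ones[of 1] by (simp add: word_power_def)
  from is_fc_word.mediant[OF _ this Suc] show ?case
    by (simp add: farey_pair_def mediant_def word_power_Suc)
qed

section \<open>Slope classes, values and the blockwise action on FC words\<close>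

lemma fc_word_in_FC: "0 < p \<Longrightarrow> 0 < q \<Longrightarrow> coprime p q \<Longrightarrow> fc_word (p, q) \<in> FC"
  unfolding FC_def pos_fraction_def by blast

lemma fc_word_in_FC_lt1: "0 < p \<Longrightarrow> p < q \<Longrightarrow> coprime p q \<Longrightarrow> fc_word (p, q) \<in> FC_lt1"
  by (simp add: FC_lt1_def fc_word_in_FC slope_fc_word)

lemma fc_word_in_FC_ge1: "0 < q \<Longrightarrow> q \<le> p \<Longrightarrow> coprime p q \<Longrightarrow> fc_word (p, q) \<in> FC_ge1"
  by (simp add: FC_ge1_def fc_word_in_FC slope_fc_word)

lemma fc_value_lt1:
  "0 < p \<Longrightarrow> p < q \<Longrightarrow> coprime p q \<Longrightarrow> fc_value (fc_word (p, q)) = q div p"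
  by (simp add: fc_value_def slope_fc_word floor_divide_of_nat_eq)

lemma fc_value_ge1:
  "0 < q \<Longrightarrow> q \<le> p \<Longrightarrow> coprime p q \<Longrightarrow> fc_value (fc_word (p, q)) = p div q"
  by (simp add: fc_value_def slope_fc_word floor_divide_of_nat_eq)

text \<open>Dividing \<open>q\<close> by \<open>p\<close> expresses both siblings as images of one
  word \<open>z\<close>, under substitutions whose blocks are exactly those exchanged by
  \<open>T0_map\<close>.\<close>

lemma T0_map_siblings:
  assumes "0 < p" "0 < q" and cop: "coprime p q"
  shows "(fc_word (p, p + q), fc_word (p + q, q)) \<in> T0_map"
proof -
  define j where "j = q div p"
  define k where "k = Suc j"
  define r where "r = q mod p"
  have r: "r < p" and q: "q = j * p + r" using assms by (simp_all add: r_def j_def)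
  \<comment> \<open>\<open>(p, q)\<close> is reached from \<open>(p - r, r)\<close> by the path \<open>R L^j\<close>, so the letters of \<open>z\<close>
    correspond to the blocks of \<open>fc_word (p, p + q)\<close>\<close>
  define z where "z = fc_word (p - r, r)"
  \<comment> \<open>If \<open>r = 0\<close>, then \<open>p = 1\<close> and \<open>z\<close> is the
    word of the formal fraction 1/0, so the substitution lemma is needed for formal fractions
    too.\<close>
  have cz: "coprime (p - r) r"
  proof -
    have "gcd p r = gcd p q" unfolding r_def by (metis gcd.commute gcd_red_nat)
    then show ?thesis using cop r
      by (metis coprime_iff_gcd_eq_1 gcd_diff1_nat less_imp_le)
  qed
  define ns where "ns = map (\<lambda>s. if s = 0 then k + 1 else k) z"
  obtain m where m: "p = r + m" using r less_imp_add_positive by blast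
  have "fc_word (p, p + q) = subst (word_power [0] (Suc k) @ [1]) (word_power [0] k @ [1]) z"
    using fc_word_subst[OF _ is_fc_word_zeros_one[of "Suc k"] is_fc_word_zeros_one[of k] cz]
    by (simp add: farey_pair_def z_def q m k_def algebra_simps)
  then have w: "fc_word (p, p + q) = concat (map (\<lambda>n. word_power [0] n @ [1]) ns)"
    unfolding ns_def concat_blocks_eq_subst by simp
  have "fc_word (p + q, q) = subst (word_power [0, 1] k @ [1]) (word_power [0, 1] j @ [1]) z"
    using fc_word_subst[OF _ is_fc_word_alternating[of k] is_fc_word_alternating[of j] cz]
    by (simp add: farey_pair_def z_def q m k_def algebra_simps)
  then have w': "fc_word (p + q, q) = concat (map (\<lambda>n. if n = k + 1 then word_power [0, 1] k @ [1]
      else word_power [0, 1] (k - 1) @ [1]) ns)"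
    unfolding ns_def concat_blocks_eq_subst by (simp add: k_def)
  have c: "coprime p (p + q)" using cop by (simp add: coprime_iff_gcd_eq_1)
  have "fc_value (fc_word (p, p + q)) = k"
    using fc_value_lt1[OF _ _ c] assms by (simp add: k_def j_def)
  moreover have "fc_word (p, p + q) \<in> FC_lt1"
    using fc_word_in_FC_lt1[OF _ _ c] assms by simp
  moreover have "set ns \<subseteq> {k, k + 1}" by (auto simp: ns_def)
  ultimately show ?thesis using w w' unfolding T0_map_def by blast
qed

text \<open>These are the fractions reached from \<open>(a, b)\<close> by L R^k and R L^k; each edge
  of the tree is a Euclidean step and preserves the gcd.\<close>

lemma coprime_cousins:
  fixes a b k :: nat
  assumes "coprime a b"
  shows "coprime (a + k * (a + b)) (a + b)" "coprime (a + b) (b + k * (a + b))"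
proof -
  have "gcd (a + b) a = gcd a b" "gcd (a + b) b = gcd a b"
    by (metis gcd.commute gcd_add2) simp
  then have "gcd (a + b) (k * (a + b) + a) = 1" "gcd (a + b) (k * (a + b) + b) = 1"
    using assms unfolding gcd_add_mult by (simp_all add: coprime_iff_gcd_eq_1)
  then show "coprime (a + k * (a + b)) (a + b)" "coprime (a + b) (b + k * (a + b))"
    by (simp_all only: coprime_iff_gcd_eq_1 gcd.commute add.commute)
qed

lemma T1_map_cousins:
  assumes "0 < b" "coprime a b" "0 < k"
  shows "(fc_word (a + k * (a + b), a + b), fc_word (a + b, b + k * (a + b))) \<in> T1_map"
proof -
  define z where "z = fc_word (a, b)"
  define ns where "ns = map (\<lambda>s. if s = 0 then k else k + 1) z"
  define x where "x = fc_word (a + k * (a + b), a + b)"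
  have "x = subst ([0] @ word_power [1] k) ([0] @ word_power [1] (Suc k)) z"
    using fc_word_subst[OF _ is_fc_word_zero_ones[of k] is_fc_word_zero_ones[of "Suc k"] assms(2)]
    by (simp add: farey_pair_def z_def x_def algebra_simps)
  then have w: "x = concat (map (\<lambda>n. [0] @ word_power [1] n) ns)"
    unfolding ns_def concat_blocks_eq_subst by simp
  have "fc_word (a + b, b + k * (a + b))
      = subst (word_power [0] (Suc k) @ [1]) (word_power [0] k @ [1]) z"
    using fc_word_subst[OF _ is_fc_word_zeros_one[of "Suc k"] is_fc_word_zeros_one[of k] assms(2)]
    by (simp add: farey_pair_def z_def algebra_simps)
  then have w': "fc_word (a + b, b + k * (a + b)) = concat (map (\<lambda>n. if n = k + 1
      then word_power [0] k @ [1] else word_power [0] (k + 1) @ [1]) ns)"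
    unfolding ns_def concat_blocks_eq_subst by simp
  note c = coprime_cousins(1)[OF assms(2), of k]
  have le: "a + b \<le> a + k * (a + b)"
    using assms(3) by (cases k) simp_all
  \<comment> \<open>As \<open>0 < b\<close>, the number \<open>a\<close> is a proper remainder
    modulo \<open>a + b\<close>.\<close>
  have "(a + k * (a + b)) div (a + b) = k" using assms by simp
  then have val: "fc_value x = k"
    using fc_value_ge1[OF _ le c] assms(1) by (simp add: x_def)
  have mem: "x \<in> FC_ge1"
    using fc_word_in_FC_ge1[OF _ le c] assms(1) by (simp add: x_def)
  have sub: "set ns \<subseteq> {k, k + 1}" by (auto simp: ns_def)
  show ?thesis
    unfolding T1_map_def x_def[symmetric] mem_Collect_eq case_prod_conv
    by (intro conjI exI[of _ ns] exI[of _ k] mem val[symmetric] sub w w')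
qed

text \<open>Allowing \<open>a = 0\<close> (hence \<open>b = 1\<close>) for positive \<open>j\<close>
  brings in the formal ancestor 0/1 of a row change; for \<open>j = 0\<close> it would make
  \<open>x\<close> the formal fraction 0/1.\<close>

definition neighbours :: "fraction \<Rightarrow> fraction \<Rightarrow> bool" where
  "neighbours x y \<longleftrightarrow> (\<exists>a b j. coprime a b \<and> 0 < b \<and> (j = 0 \<longrightarrow> 0 < a) \<and>
     x = (a + j * (a + b), a + b) \<and> y = (a + b, b + j * (a + b)))"

text \<open>Appending R to the left path and L to the right one keeps the ancestor and raises
  \<open>j\<close> by one.\<close>

lemma neighbours_step: "neighbours (p, q) (r, s) \<Longrightarrow> neighbours (p + q, q) (r, r + s)"
proof -
  assume "neighbours (p, q) (r, s)"
  then obtain a b j where "coprime a b" "0 < b" "p = a + j * (a + b)" "q = a + b"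
      "r = a + b" "s = b + j * (a + b)"
    unfolding neighbours_def by blast
  then show "neighbours (p + q, q) (r, r + s)"
    unfolding neighbours_def by (intro exI[of _ a] exI[of _ b] exI[of _ "Suc j"]) simp
qed

lemma neighbours_siblings:
  "0 < p \<Longrightarrow> 0 < q \<Longrightarrow> coprime p q \<Longrightarrow> neighbours (p, p + q) (p + q, q)"
  unfolding neighbours_def
  by (rule exI[of _ p], rule exI[of _ q], rule exI[of _ 0]) simp

text \<open>\<open>T0_map\<close> and \<open>T1_map\<close> restrict only the first word by
  definition; the slope class of the second is recorded here to obtain their ranges.\<close>

lemma fc_word_neighbours:
  assumes "neighbours x y"
  shows "(fc_word x, fc_word y) \<in> T0_map \<inter> FC_lt1 \<times> FC_ge1 \<union> T1_map \<inter> FC_ge1 \<times> FC_lt1"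
proof -
  obtain a b j where ab: "coprime a b" "0 < b" "j = 0 \<longrightarrow> 0 < a"
    and x: "x = (a + j * (a + b), a + b)" and y: "y = (a + b, b + j * (a + b))"
    using assms unfolding neighbours_def by (elim exE conjE) (rule that)
  note c = coprime_cousins[OF ab(1), of j]
  show ?thesis
  proof (cases "j = 0")
    case True
    then have "x = (a, a + b)" "y = (a + b, b)" "0 < a" "coprime a (a + b)" "coprime (a + b) b"
      using ab(3) x y c by simp_all
    then show ?thesis
      using ab T0_map_siblings[of a b] fc_word_in_FC_lt1[of a "a + b"] fc_word_in_FC_ge1[of b "a + b"]
      by simp
  next
    case False
    then have le: "a + b \<le> j * (a + b)" by simp
    have "fc_word x \<in> FC_ge1"
      unfolding x using le ab by (intro fc_word_in_FC_ge1 c) linarith+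
    moreover have "fc_word y \<in> FC_lt1"
      unfolding y using le ab by (intro fc_word_in_FC_lt1 c) linarith+
    moreover have "(fc_word x, fc_word y) \<in> T1_map"
      unfolding x y using T1_map_cousins ab False by blast
    ultimately show ?thesis by simp
  qed
qed

section \<open>Rows of the permuted tree and consecutive vertices\<close>

lemma that_row_pos: "x \<in> set (that_row n) \<Longrightarrow> pos_fraction x"
proof (induction n arbitrary: x)
  case 0
  then show ?case by (simp add: pos_fraction_def)
next
  case (Suc n)
  then obtain p q where "(p, q) \<in> set (that_row n)" and x: "x = (p, p + q) \<or> x = (p + q, q)"
    by auto
  then have "0 < p" "0 < q" "coprime p q"
    using Suc.IH[of "(p, q)"] by (simp_all add: pos_fraction_def)
  then show ?case using x by (auto simp: pos_fraction_def coprime_iff_gcd_eq_1)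
qed

text \<open>Subtracting the smaller entry from the larger moves to the parent, so the subtractive
  Euclidean algorithm climbs to the root.\<close>

lemma that_row_complete:
  "0 < p \<Longrightarrow> 0 < q \<Longrightarrow> coprime p q \<Longrightarrow> \<exists>n. (p, q) \<in> set (that_row n)"
proof (induction "p + q" arbitrary: p q rule: less_induct)
  case less
  consider "p < q" | "q < p" | "p = q" by linarith
  then show ?case
  proof cases
    case 1
    then obtain m where m: "q = p + m" "0 < m" using less_imp_add_positive by blast
    then have "coprime p m" using less.prems by (simp add: coprime_iff_gcd_eq_1)
    then obtain n where "(p, m) \<in> set (that_row n)"
      using less.hyps[of p m] less.prems m by auto
    then have "(p, q) \<in> set (that_row (Suc n))" using m by force
    then show ?thesis ..
  next
    case 2
    then obtain m where m: "p = m + q" "0 < m"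
      using less_imp_add_positive by (metis add.commute)
    then have "coprime m q" using less.prems by (simp add: coprime_iff_gcd_eq_1)
    then obtain n where "(m, q) \<in> set (that_row n)"
      using less.hyps[of m q] less.prems m by auto
    then have "(p, q) \<in> set (that_row (Suc n))" using m by force
    then show ?thesis ..
  next
    case 3
    then have "(p, q) \<in> set (that_row 0)" using less.prems by simp
    then show ?thesis ..
  qed
qed

text \<open>A row of children has two kinds of adjacency: siblings, and the right child of one
  vertex followed by the left child of the next.\<close>

lemma successively_concat_pairs:
  assumes "successively P xs"
    and "\<And>x. x \<in> set xs \<Longrightarrow> P (f x) (g x)" and "\<And>x y. P x y \<Longrightarrow> P (g x) (f y)"
  shows "successively P (concat (map (\<lambda>x. [f x, g x]) xs))"
  using assms by (induction xs rule: induct_list012) auto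

lemma that_row_Suc:
  "that_row (Suc n)
    = concat (map (\<lambda>x. [(fst x, fst x + snd x), (fst x + snd x, snd x)]) (that_row n))"
  by (simp add: case_prod_beta')

lemma successively_neighbours_that_row: "successively neighbours (that_row n)"
proof (induction n)
  case (Suc n)
  show ?case unfolding that_row_Suc
  proof (rule successively_concat_pairs[OF Suc])
    fix x assume "x \<in> set (that_row n)"
    then have "pos_fraction x" by (rule that_row_pos)
    then show "neighbours (fst x, fst x + snd x) (fst x + snd x, snd x)"
      by (cases x) (simp add: pos_fraction_def neighbours_siblings)
  next
    fix x y assume "neighbours x y"
    then show "neighbours (fst x + snd x, snd x) (fst y, fst y + snd y)"
      by (cases x; cases y) (simp add: neighbours_step)
  qed
qed simp

lemma that_row_ends:
  "that_row n \<noteq> [] \<and> hd (that_row n) = (1, Suc n) \<and> last (that_row n) = (Suc n, 1)"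
proof (induction n)
  case (Suc n)
  obtain xs where "that_row n = (1, Suc n) # xs"
    using Suc by (metis list.collapse)
  moreover obtain ys where "that_row n = ys @ [(Suc n, 1)]"
    using Suc by (metis append_butlast_last_id)
  then have "that_row (Suc n) \<noteq> [] \<and> last (that_row (Suc n)) = (Suc (Suc n), 1)" by simp
  ultimately show ?case by simp
qed simp

lemma neighbours_rows: "neighbours (Suc n, 1) (1, Suc (Suc n))"
  unfolding neighbours_def
  by (rule exI[of _ 0], rule exI[of _ 1], rule exI[of _ "Suc n"]) simp

lemma T_map_neighbours:
  assumes "(w, w') \<in> T_map"
  shows "\<exists>x y. neighbours x y \<and> w = fc_word x \<and> w' = fc_word y"
proof -
  consider n i where "Suc i < length (fhat_row n)" "w = fhat_row n ! i" "w' = fhat_row n ! Suc i"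
    | n where "w = last (fhat_row n)" "w' = hd (fhat_row (Suc n))"
    using assms unfolding T_map_def by fast
  then show ?thesis
  proof cases
    case 1
    then have "w = fc_word (that_row n ! i)" "w' = fc_word (that_row n ! Suc i)"
      by (simp_all add: fhat_row_def)
    moreover have "neighbours (that_row n ! i) (that_row n ! Suc i)"
      using 1(1) successively_neighbours_that_row[of n]
      by (simp add: fhat_row_def successively_conv_nth)
    ultimately show ?thesis by (intro exI conjI)
  next
    case 2
    then have "w = fc_word (Suc n, 1)" "w' = fc_word (1, Suc (Suc n))"
      using that_row_ends[of n] that_row_ends[of "Suc n"]
      by (simp_all add: fhat_row_def last_map hd_map del: that_row.simps)
    then show ?thesis using neighbours_rows by (intro exI conjI)
  qed
qed

text \<open>Every positive fraction occurs in some row, and its word has a successor there or, at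
  the end, in the next row.\<close>

lemma Domain_T_map: "FC \<subseteq> Domain T_map"
proof
  fix w assume "w \<in> FC"
  then obtain p q where "0 < p" "0 < q" "coprime p q" and w: "w = fc_word (p, q)"
    by (auto simp: FC_def pos_fraction_def)
  then obtain n where "(p, q) \<in> set (that_row n)" using that_row_complete by blast
  then have "w \<in> set (fhat_row n)" unfolding w fhat_row_def by simp
  then obtain i where i: "i < length (fhat_row n)" "w = fhat_row n ! i"
    by (metis in_set_conv_nth)
  show "w \<in> Domain T_map"
  proof (cases "Suc i < length (fhat_row n)")
    case True
    then show ?thesis using i unfolding T_map_def by blast
  next
    case False
    then have "i = length (fhat_row n) - 1" using i by linarith
    moreover have "fhat_row n \<noteq> []" using i by auto
    ultimately have "w = last (fhat_row n)" using i by (simp add: last_conv_nth)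
    then show ?thesis unfolding T_map_def by blast
  qed
qed

section \<open>Uniqueness of the block decomposition\<close>

lemma concat_blocks_inject:
  assumes "a \<noteq> b"
    and "concat (map (\<lambda>n. replicate n a @ [b]) ns) = concat (map (\<lambda>n. replicate n a @ [b]) ms)"
  shows "ns = ms"
  using assms(2)
proof (induction ns arbitrary: ms)
  case Nil
  then show ?case by (cases ms) auto
next
  case (Cons n ns)
  obtain m ms' where ms: "ms = m # ms'" using Cons.prems by (cases ms) auto
  \<comment> \<open>The separator \<open>b\<close> differs from \<open>a\<close>, so the initial run
    of \<open>a\<close> recovers the first exponent.\<close>
  have first_block: "length (takeWhile (\<lambda>s. s = a) (replicate n a @ b # w)) = n" for n w
    using assms(1) by (induction n) simp_all
  have eq: "replicate n a @ b # concat (map (\<lambda>n. replicate n a @ [b]) ns)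
      = replicate m a @ b # concat (map (\<lambda>n. replicate n a @ [b]) ms')"
    using Cons.prems by (simp add: ms)
  then have "n = m" by (metis first_block)
  then show ?case using eq Cons.IH by (simp add: ms)
qed

text \<open>The value \<open>k\<close> is determined by the word, so only the exponent list could
  vary, and it can be read off the word.\<close>

lemma single_valued_T0_map: "single_valued T0_map"
proof (rule single_valuedI)
  fix w w' w'' assume "(w, w') \<in> T0_map" "(w, w'') \<in> T0_map"
  moreover have "ns = ms" if "concat (map (\<lambda>n. word_power [0::nat] n @ [1]) ns)
      = concat (map (\<lambda>n. word_power [0] n @ [1]) ms)" for ns ms
    using that unfolding word_power_single by (rule concat_blocks_inject[rotated]) simp
  ultimately show "w' = w''" unfolding T0_map_def by blast
qed

text \<open>Blocks of \<open>T1_map\<close> start with their separator; shifting it by one place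
  reduces them to blocks that end with it.\<close>

lemma concat_shift_separator:
  "concat (map (\<lambda>n. [b] @ replicate n a) ns) @ [b] = b # concat (map (\<lambda>n. replicate n a @ [b]) ns)"
  by (induction ns) auto

lemma single_valued_T1_map: "single_valued T1_map"
proof (rule single_valuedI)
  fix w w' w'' assume "(w, w') \<in> T1_map" "(w, w'') \<in> T1_map"
  moreover have "ns = ms" if "concat (map (\<lambda>n. [0] @ word_power [1::nat] n) ns)
      = concat (map (\<lambda>n. [0] @ word_power [1] n) ms)" for ns ms
  proof (rule concat_blocks_inject)
    show "concat (map (\<lambda>n. replicate n 1 @ [0::nat]) ns) = concat (map (\<lambda>n. replicate n 1 @ [0]) ms)"
      using that concat_shift_separator[of "0::nat" 1 ns] concat_shift_separator[of "0::nat" 1 ms]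
      unfolding word_power_single by simp
  qed simp
  ultimately show "w' = w''" unfolding T1_map_def by blast
qed

theorem theorem3p7:
  shows "function_graph FC FC T_map
    \<and> function_graph FC_lt1 FC_ge1 T0_map
    \<and> function_graph FC_ge1 FC_lt1 T1_map
    \<and> T_map = T0_map \<union> T1_map"
proof -
  have T: "T_map \<subseteq> T0_map \<inter> FC_lt1 \<times> FC_ge1 \<union> T1_map \<inter> FC_ge1 \<times> FC_lt1"
  proof (rule subrelI)
    fix w w' assume "(w, w') \<in> T_map"
    then obtain x y where "neighbours x y" and w: "w = fc_word x" "w' = fc_word y"
      using T_map_neighbours by blast
    then show "(w, w') \<in> T0_map \<inter> FC_lt1 \<times> FC_ge1 \<union> T1_map \<inter> FC_ge1 \<times> FC_lt1"
      unfolding w by (intro fc_word_neighbours)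
  qed
  have dom: "Domain T0_map \<subseteq> FC_lt1" "Domain T1_map \<subseteq> FC_ge1"
    by (auto simp: T0_map_def T1_map_def)
  have FC: "FC_lt1 \<inter> FC_ge1 = {}" "FC_lt1 \<union> FC_ge1 = FC"
    by (auto simp: FC_lt1_def FC_ge1_def)
  \<comment> \<open>By totality \<open>w\<close> has a successor \<open>v\<close>; its slope class
    puts \<open>(w, v)\<close> into \<open>T0_map\<close>, and single-valuedness gives
    \<open>v = w'\<close>. The inclusion for \<open>T1_map\<close> is analogous.\<close>
  have T0: "T0_map \<subseteq> T_map \<inter> FC_lt1 \<times> FC_ge1"
  proof (rule subrelI)
    fix w w' assume ww': "(w, w') \<in> T0_map"
    then have w: "w \<in> FC_lt1" using dom by blast
    then obtain v where v: "(w, v) \<in> T_map" using Domain_T_map FC by blast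
    then have "(w, v) \<in> T0_map" "v \<in> FC_ge1" using T w FC by blast+
    moreover then have "v = w'" using ww' single_valued_T0_map by (blast dest: single_valuedD)
    ultimately show "(w, w') \<in> T_map \<inter> FC_lt1 \<times> FC_ge1" using v w by blast
  qed
  have T1: "T1_map \<subseteq> T_map \<inter> FC_ge1 \<times> FC_lt1"
  proof (rule subrelI)
    fix w w' assume ww': "(w, w') \<in> T1_map"
    then have w: "w \<in> FC_ge1" using dom by blast
    then obtain v where v: "(w, v) \<in> T_map" using Domain_T_map FC by blast
    then have "(w, v) \<in> T1_map" "v \<in> FC_lt1" using T w FC by blast+
    moreover then have "v = w'" using ww' single_valued_T1_map by (blast dest: single_valuedD)
    ultimately show "(w, w') \<in> T_map \<inter> FC_ge1 \<times> FC_lt1" using v w by blast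
  qed
  have eq: "T_map = T0_map \<union> T1_map" using T T0 T1 by blast
  \<comment> \<open>Inherited from the two blockwise maps, whose domains are disjoint.\<close>
  have "single_valued T_map"
    unfolding single_valued_def
    using T FC single_valued_T0_map single_valued_T1_map by (blast dest: single_valuedD)
  moreover have "Domain T_map = FC" using Domain_T_map T FC by blast
  moreover have "Range T_map \<subseteq> FC" using T FC by blast
  moreover have "Domain T0_map = FC_lt1" "Domain T1_map = FC_ge1"
    using Domain_T_map T FC dom by blast+
  moreover have "Range T0_map \<subseteq> FC_ge1" "Range T1_map \<subseteq> FC_lt1" using T0 T1 by blast+
  ultimately show ?thesis
    using eq single_valued_T0_map single_valued_T1_map by (simp add: function_graph_def)
qed

end
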